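(* Let $\psi\in\mathcal{D}$ be a DQBF over $V$ and let $\exists y(D_y):\varphi$ be a subformula of $\psi$ with $y\notin V_\varphi$. Let $\psi'$ result from $\psi$ by replacing the subformula $\exists y(D_y):\varphi$ by $\varphi$. Then $\psi$ and $\psi'$ are equisatisfiable.
   Context: Notation: $\mathcal{F}(W)$ is the set of Boolean functions over variable set $W$; $\mathrm{supp}(f)$ the set of variables $f$ depends on. Syntax (non-closed non-prenex DQBFs in NNF over a finite variable set $V$). The set $\mathcal{D}$, with for each $\psi$ the sets $V^{\exists}_\psi$ (existential), $V^{\forall}_\psi$ (universal), $V^{\mathrm{fs}}_\psi$ (free variables occurring in $\psi$), and a dependency set $D_y\subseteq V$ for each existential $y$, is the smallest set closed under: (1) $v\in\mathcal{D}$ for $v\in V$ ($V^\exists=V^\forall=\emptyset$, $V^{\mathrm{fs}}=\{v\}$); (2) $\neg v\in\mathcal{D}$, same sets; (3),(4) if $\varphi_1,\varphi_2\in\mathcal{D}$ and $\bigl(V^Q_{\varphi_1}\cup V^{\mathrm{fs}}_{\varphi_1}\cup\bigcup_{y\in V^\exists_{\varphi_1}}D_y\bigr)\cap V^Q_{\varphi_2}=\emptyset$ and symmetrically, then $(\varphi_1\wedge\varphi_2),(\varphi_1\vee\varphi_2)\in\mathcal{D}$ with all three sets the unions; (5) if $\varphi\in\mathcal{D}$, $v\in V^{\mathrm{free}}_\varphi$, $D_v\subseteq V\setminus(V^Q_\varphi\cup\{v\})$, then $\exists v(D_v):\varphi^{-v}\in\mathcal{D}$ ($\varphi^{-v}$: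 remove $v$ from all dependency sets in $\varphi$), with $V^\exists=V^\exists_\varphi\cup\{v\}$, $V^{\mathrm{fs}}=V^{\mathrm{fs}}_\varphi\setminus\{v\}$; (6) if $\varphi\in\mathcal{D}$, $v\in V^{\mathrm{free}}_\varphi$, then $\forall v:\varphi\in\mathcal{D}$ with $V^\forall=V^\forall_\varphi\cup\{v\}$, $V^{\mathrm{fs}}=V^{\mathrm{fs}}_\varphi\setminus\{v\}$. Here $V^Q_\psi=V^\exists_\psi\cup V^\forall_\psi$, $V_\psi=V^Q_\psi\cup V^{\mathrm{fs}}_\psi$, $V^{\mathrm{free}}_\psi=V\setminus V^Q_\psi$. Semantics. A Skolem function candidate for $\psi$ is a map $s:V^{\mathrm{free}}_\psi\cup V^\exists_\psi\to\mathcal{F}(V^\forall_\psi)$ with $s(v)$ constant for free $v$ and $\mathrm{supp}(s(v))\subseteq D_v\cap V^\forall_\psi$ for existential $v$. $s(\psi)$ replaces each such $v$ by $s(v)$ and deletes quantifiers. $[\![\psi]\!]$ is the set of candidates $s$ with $s(\psi)$ a tautology. $\psi_1\approx\psi_2$ (equisatisfiable) iff $[\![\psi_1]\!]=\emptyset\Leftrightarrow[\![\psi_2]\!]=\emptyset$. *)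

theory Defs
  imports Main "HOL-Library.FuncSet"
begin

text \<open>
  Each existential quantifier carries its dependency set. In the formulas of \<open>DQBF V\<close> below every
  variable is quantified at most once, so this is the same as having one set per existential
  variable (recovered by \<open>dep\<close>).
\<close>

datatype 'v dqbf =
    Pos 'v
  | Neg 'v
  | And "'v dqbf" "'v dqbf"
  | Or "'v dqbf" "'v dqbf"
  | Exists 'v "'v set" "'v dqbf"
  | Forall 'v "'v dqbf"

fun V_ex :: "'v dqbf \<Rightarrow> 'v set" where
  "V_ex (Pos v) = {}"
| "V_ex (Neg v) = {}"
| "V_ex (And p q) = V_ex p \<union> V_ex q"
| "V_ex (Or p q) = V_ex p \<union> V_ex q"
| "V_ex (Exists v D p) = V_ex p \<union> {v}"
| "V_ex (Forall v p) = V_ex p"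

fun V_all :: "'v dqbf \<Rightarrow> 'v set" where
  "V_all (Pos v) = {}"
| "V_all (Neg v) = {}"
| "V_all (And p q) = V_all p \<union> V_all q"
| "V_all (Or p q) = V_all p \<union> V_all q"
| "V_all (Exists v D p) = V_all p"
| "V_all (Forall v p) = V_all p \<union> {v}"

fun V_fs :: "'v dqbf \<Rightarrow> 'v set" where
  "V_fs (Pos v) = {v}"
| "V_fs (Neg v) = {v}"
| "V_fs (And p q) = V_fs p \<union> V_fs q"
| "V_fs (Or p q) = V_fs p \<union> V_fs q"
| "V_fs (Exists v D p) = V_fs p - {v}"
| "V_fs (Forall v p) = V_fs p - {v}"

definition V_Q :: "'v dqbf \<Rightarrow> 'v set" where
  "V_Q p = V_ex p \<union> V_all p"

definition vars :: "'v dqbf \<Rightarrow> 'v set" where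
  "vars p = V_Q p \<union> V_fs p"

definition V_free :: "'v set \<Rightarrow> 'v dqbf \<Rightarrow> 'v set" where
  "V_free V p = V - V_Q p"

text \<open>The dependency set of \<open>y\<close> in a formula; only meaningful for existential \<open>y\<close>.\<close>

fun dep :: "'v dqbf \<Rightarrow> 'v \<Rightarrow> 'v set" where
  "dep (Pos v) y = {}"
| "dep (Neg v) y = {}"
| "dep (And p q) y = dep p y \<union> dep q y"
| "dep (Or p q) y = dep p y \<union> dep q y"
| "dep (Exists v D p) y = (if y = v then D else dep p y)"
| "dep (Forall v p) y = dep p y"

fun remove_dep :: "'v \<Rightarrow> 'v dqbf \<Rightarrow> 'v dqbf" where
  "remove_dep v (Pos x) = Pos x"
| "remove_dep v (Neg x) = Neg x"
| "remove_dep v (And p q) = And (remove_dep v p) (remove_dep v q)"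
| "remove_dep v (Or p q) = Or (remove_dep v p) (remove_dep v q)"
| "remove_dep v (Exists x D p) = Exists x (D - {v}) (remove_dep v p)"
| "remove_dep v (Forall x p) = Forall x (remove_dep v p)"

definition separated :: "'v dqbf \<Rightarrow> 'v dqbf \<Rightarrow> bool" where
  "separated p q \<longleftrightarrow> (V_Q p \<union> V_fs p \<union> (\<Union>y\<in>V_ex p. dep p y)) \<inter> V_Q q = {}"

inductive_set DQBF :: "'v set \<Rightarrow> 'v dqbf set" for V :: "'v set" where
  Pos: "v \<in> V \<Longrightarrow> Pos v \<in> DQBF V"
| Neg: "v \<in> V \<Longrightarrow> Neg v \<in> DQBF V"
| And: "\<lbrakk>p \<in> DQBF V; q \<in> DQBF V; separated p q; separated q p\<rbrakk> \<Longrightarrow> And p q \<in> DQBF V"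
| Or: "\<lbrakk>p \<in> DQBF V; q \<in> DQBF V; separated p q; separated q p\<rbrakk> \<Longrightarrow> Or p q \<in> DQBF V"
| Exists: "\<lbrakk>p \<in> DQBF V; v \<in> V_free V p; D \<subseteq> V - (V_Q p \<union> {v})\<rbrakk>
        \<Longrightarrow> Exists v D (remove_dep v p) \<in> DQBF V"
| Forall: "\<lbrakk>p \<in> DQBF V; v \<in> V_free V p\<rbrakk> \<Longrightarrow> Forall v p \<in> DQBF V"

text \<open>
  A Boolean function over \<open>W\<close> is represented as a function on assignments to all variables whose
  value is determined by the restriction of the assignment to \<open>W\<close>.
\<close>

type_synonym 'v bfun = "('v \<Rightarrow> bool) \<Rightarrow> bool"

definition bool_funs :: "'v set \<Rightarrow> 'v bfun set" where
  "bool_funs W = {f. \<forall>a b. (\<forall>w\<in>W. a w = b w) \<longrightarrow> f a = f b}"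

definition supp :: "'v bfun \<Rightarrow> 'v set" where
  "supp f = {v. \<exists>a. f (a(v := False)) \<noteq> f (a(v := True))}"

definition candidates :: "'v set \<Rightarrow> 'v dqbf \<Rightarrow> ('v \<Rightarrow> 'v bfun) set" where
  "candidates V p =
     {s \<in> V_free V p \<union> V_ex p \<rightarrow>\<^sub>E bool_funs (V_all p).
        (\<forall>v\<in>V_free V p. \<exists>c. s v = (\<lambda>_. c)) \<and>
        (\<forall>v\<in>V_ex p. supp (s v) \<subseteq> dep p v \<inter> V_all p)}"

text \<open>
  \<open>subst_matrix X s p\<close> is the Boolean function denoted by \<open>p\<close> once all quantifiers are deleted and
  every variable \<open>v \<in> X\<close> is replaced by \<open>s v\<close>.
\<close>

fun subst_matrix :: "'v set \<Rightarrow> ('v \<Rightarrow> 'v bfun) \<Rightarrow> 'v dqbf \<Rightarrow> 'v bfun" where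
  "subst_matrix X s (Pos v) = (\<lambda>a. if v \<in> X then s v a else a v)"
| "subst_matrix X s (Neg v) = (\<lambda>a. \<not> (if v \<in> X then s v a else a v))"
| "subst_matrix X s (And p q) = (\<lambda>a. subst_matrix X s p a \<and> subst_matrix X s q a)"
| "subst_matrix X s (Or p q) = (\<lambda>a. subst_matrix X s p a \<or> subst_matrix X s q a)"
| "subst_matrix X s (Exists v D p) = subst_matrix X s p"
| "subst_matrix X s (Forall v p) = subst_matrix X s p"

definition apply_candidate :: "'v set \<Rightarrow> ('v \<Rightarrow> 'v bfun) \<Rightarrow> 'v dqbf \<Rightarrow> 'v bfun" where
  "apply_candidate V s p = subst_matrix (V_free V p \<union> V_ex p) s p"

definition tautology :: "'v bfun \<Rightarrow> bool" where
  "tautology f \<longleftrightarrow> (\<forall>a. f a)"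

definition sem :: "'v set \<Rightarrow> 'v dqbf \<Rightarrow> ('v \<Rightarrow> 'v bfun) set" where
  "sem V p = {s \<in> candidates V p. tautology (apply_candidate V s p)}"

definition equisat :: "'v set \<Rightarrow> 'v dqbf \<Rightarrow> 'v dqbf \<Rightarrow> bool" where
  "equisat V p q \<longleftrightarrow> (sem V p = {} \<longleftrightarrow> sem V q = {})"

fun subformulas :: "'v dqbf \<Rightarrow> 'v dqbf set" where
  "subformulas (Pos v) = {Pos v}"
| "subformulas (Neg v) = {Neg v}"
| "subformulas (And p q) = insert (And p q) (subformulas p \<union> subformulas q)"
| "subformulas (Or p q) = insert (Or p q) (subformulas p \<union> subformulas q)"
| "subformulas (Exists v D p) = insert (Exists v D p) (subformulas p)"
| "subformulas (Forall v p) = insert (Forall v p) (subformulas p)"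

text \<open>
  \<open>replace r r' p\<close> replaces every (outermost) occurrence of \<open>r\<close> in \<open>p\<close> by \<open>r'\<close>. A subformula
  starting with a quantifier occurs exactly once in a formula of \<open>DQBF V\<close>, because no variable is
  quantified twice; for such \<open>r\<close> this is the replacement of the single occurrence.
\<close>

fun replace :: "'v dqbf \<Rightarrow> 'v dqbf \<Rightarrow> 'v dqbf \<Rightarrow> 'v dqbf" where
  "replace r r' (Pos v) = (if Pos v = r then r' else Pos v)"
| "replace r r' (Neg v) = (if Neg v = r then r' else Neg v)"
| "replace r r' (And p q) =
     (if And p q = r then r' else And (replace r r' p) (replace r r' q))"
| "replace r r' (Or p q) =
     (if Or p q = r then r' else Or (replace r r' p) (replace r r' q))"
| "replace r r' (Exists v D p) = (if Exists v D p = r then r' else Exists v D (replace r r' p))"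
| "replace r r' (Forall v p) = (if Forall v p = r then r' else Forall v (replace r r' p))"

end

theory Submission
  imports Defs
begin

text \<open>
  Since no variable is quantified twice in a DQBF, the quantifier on \<open>y\<close> is the only place where \<open>y\<close>
  occurs in \<open>\<psi>\<close>. Deleting it keeps the matrix, the universal variables and all the other dependency
  sets, and merely turns \<open>y\<close> from an existential into a free variable. As \<open>y\<close> does not occur in the
  matrix, its Skolem function may be overwritten by a constant, which is admissible for a free and
  for an existential variable alike.
\<close>

text \<open>A structural invariant of \<open>DQBF V\<close> that ignores dependency sets: the body
  of an existential quantifier is \<open>remove_dep v p\<close> rather than the \<open>p\<close> of
  the formation rule, and the invariant passes unchanged between the two.\<close>

fun quantified_once :: "'v dqbf \<Rightarrow> bool" where
  "quantified_once (Pos v) \<longleftrightarrow> True"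
| "quantified_once (Neg v) \<longleftrightarrow> True"
| "quantified_once (And p q) \<longleftrightarrow> quantified_once p \<and> quantified_once q \<and>
     vars p \<inter> V_Q q = {} \<and> vars q \<inter> V_Q p = {}"
| "quantified_once (Or p q) \<longleftrightarrow> quantified_once p \<and> quantified_once q \<and>
     vars p \<inter> V_Q q = {} \<and> vars q \<inter> V_Q p = {}"
| "quantified_once (Exists v D p) \<longleftrightarrow> quantified_once p \<and> v \<notin> V_Q p"
| "quantified_once (Forall v p) \<longleftrightarrow> quantified_once p \<and> v \<notin> V_Q p"

lemma V_ex_remove_dep [simp]: "V_ex (remove_dep v p) = V_ex p"
  by (induction p) auto

lemma V_all_remove_dep [simp]: "V_all (remove_dep v p) = V_all p"
  by (induction p) auto

lemma V_fs_remove_dep [simp]: "V_fs (remove_dep v p) = V_fs p"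
  by (induction p) auto

lemma V_Q_remove_dep [simp]: "V_Q (remove_dep v p) = V_Q p"
  by (simp add: V_Q_def)

lemma vars_remove_dep [simp]: "vars (remove_dep v p) = vars p"
  by (simp add: vars_def)

lemma quantified_once_remove_dep [simp]:
  "quantified_once (remove_dep v p) \<longleftrightarrow> quantified_once p"
  by (induction p) auto

lemma DQBF_quantified_once: "p \<in> DQBF V \<Longrightarrow> quantified_once p"
  by (induction rule: DQBF.induct) (auto simp: separated_def vars_def V_free_def)

lemma DQBF_V_Q_subset: "p \<in> DQBF V \<Longrightarrow> V_Q p \<subseteq> V"
  by (induction rule: DQBF.induct) (auto simp: V_free_def V_Q_def)

lemma Exists_subformula_V_ex: "Exists y D r \<in> subformulas p \<Longrightarrow> y \<in> V_ex p"
  by (induction p) auto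

lemma replace_not_subformula: "r \<notin> subformulas p \<Longrightarrow> replace r r' p = p"
  by (induction p) auto

lemma V_all_replace_Exists [simp]: "V_all (replace (Exists y D r) r p) = V_all p"
  by (induction p) auto

text \<open>Comparing only modulo \<open>y\<close> lets the induction run on arbitrary formulas,
  without knowing whether \<open>y\<close> survives elsewhere.\<close>

lemma V_ex_replace_Exists: "V_ex (replace (Exists y D r) r p) - {y} = V_ex p - {y}"
  by (induction p) auto

lemma dep_replace_Exists: "v \<noteq> y \<Longrightarrow> dep (replace (Exists y D r) r p) v = dep p v"
  by (induction p) auto

lemma subst_matrix_replace_Exists:
  "subst_matrix X s (replace (Exists y D r) r p) = subst_matrix X s p"
  by (induction p) auto

lemma subst_matrix_upd: "y \<notin> vars p \<Longrightarrow> subst_matrix X (s(y := f)) p = subst_matrix X s p"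
  by (induction p) (auto simp: vars_def V_Q_def)

lemma vars_And_Or [simp]:
  "vars (And p q) = vars p \<union> vars q" "vars (Or p q) = vars p \<union> vars q"
  by (auto simp: vars_def V_Q_def)

lemma vars_quantifier [simp]:
  "vars (Exists v D p) = insert v (vars p)" "vars (Forall v p) = insert v (vars p)"
  by (auto simp: vars_def V_Q_def)

text \<open>On the path to the deleted quantifier no other binder binds \<open>y\<close>, the
  branches off the path cannot mention \<open>y\<close>, and at the end only \<open>r\<close>
  remains.\<close>

lemma notin_vars_replace_Exists:
  assumes "quantified_once p" and "Exists y D r \<in> subformulas p" and "y \<notin> vars r"
  shows "y \<notin> vars (replace (Exists y D r) r p)"
proof -
  have in_V_Q: "y \<in> V_Q q" if "Exists y D r \<in> subformulas q" for q
    using that Exists_subformula_V_ex by (auto simp: V_Q_def)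
  have V_Q_vars: "V_Q q \<subseteq> vars q" for q :: "'a dqbf"
    by (simp add: vars_def)
  \<comment> \<open>Here \<open>q\<close> is the sibling of a branch \<open>q'\<close> that
    quantifies \<open>y\<close>. It does not mention \<open>y\<close>, so it lacks the subformula
    and the replacement leaves it alone.\<close>
  have binary: "y \<notin> vars (replace (Exists y D r) r q)"
    if "y \<in> V_Q q'" and "vars q \<inter> V_Q q' = {}" for q q'
    using that in_V_Q V_Q_vars replace_not_subformula by (metis disjoint_iff subset_iff)
  show ?thesis
    using assms(1,2)
  proof (induction p)
    case (And p q)
    then show ?case
      using assms(3) in_V_Q binary[of p q] binary[of q p] by (auto split: if_splits)
  next
    case (Or p q)
    then show ?case
      using assms(3) in_V_Q binary[of p q] binary[of q p] by (auto split: if_splits)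
  next
    \<comment> \<open>Either this node is the deleted one and \<open>r\<close> is left, or
      \<open>y\<close> is quantified inside \<open>p\<close>, which forces \<open>v\<close> to
      differ from \<open>y\<close>.\<close>
    case (Exists v E p)
    then show ?case
      using assms(3) in_V_Q[of p] by auto
  next
    case (Forall v p)
    then show ?case
      using assms(3) in_V_Q[of p] by auto
  qed simp_all
qed

text \<open>Covers both directions at once: a constant has empty support, so it is admissible at
  \<open>y\<close> whether \<open>y\<close> is free or existential in \<open>q\<close>, whatever its
  dependency set.\<close>

lemma candidate_upd_const:
  assumes s: "s \<in> candidates V p"
    and dom: "V_free V q \<union> V_ex q = V_free V p \<union> V_ex p" and all: "V_all q = V_all p"
    and y: "y \<in> V_free V p \<union> V_ex p"
    and free: "V_free V q - {y} \<subseteq> V_free V p"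
    and ex: "V_ex q - {y} \<subseteq> V_ex p"
    and dep: "\<And>v. v \<noteq> y \<Longrightarrow> dep q v = dep p v"
  shows "s(y := \<lambda>_. c) \<in> candidates V q"
proof -
  have "supp (\<lambda>_. c) = {}"
    by (simp add: supp_def)
  have "(\<lambda>_. c) \<in> bool_funs (V_all p)"
    by (simp add: bool_funs_def)
  then have "s(y := \<lambda>_. c) \<in> V_free V q \<union> V_ex q \<rightarrow>\<^sub>E bool_funs (V_all q)"
    using s y unfolding candidates_def dom all by (auto simp: PiE_iff extensional_def)
  moreover have "\<exists>d. (s(y := \<lambda>_. c)) v = (\<lambda>_. d)" if "v \<in> V_free V q" for v
    using that s free by (cases "v = y") (auto simp: candidates_def)
  moreover have "supp ((s(y := \<lambda>_. c)) v) \<subseteq> dep q v \<inter> V_all q" if "v \<in> V_ex q" for v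
    using that s ex dep all \<open>supp (\<lambda>_. c) = {}\<close> by (cases "v = y") (auto simp: candidates_def)
  ultimately show ?thesis
    unfolding candidates_def by blast
qed

theorem theorem5:
  fixes V :: "'v set" and \<psi> \<phi> :: "'v dqbf" and y :: 'v and D :: "'v set"
  assumes "finite V"
    and "\<psi> \<in> DQBF V"
    and "Exists y D \<phi> \<in> subformulas \<psi>"
    and "y \<notin> vars \<phi>"
  shows "equisat V \<psi> (replace (Exists y D \<phi>) \<phi> \<psi>)"
proof -
  let ?\<psi>' = "replace (Exists y D \<phi>) \<phi> \<psi>"
  have y_ex: "y \<in> V_ex \<psi>"
    using assms(3) by (rule Exists_subformula_V_ex)
  have y_V: "y \<in> V"
    using y_ex DQBF_V_Q_subset[OF assms(2)] by (auto simp: V_Q_def)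
  have fresh: "y \<notin> vars ?\<psi>'"
    using notin_vars_replace_Exists[OF DQBF_quantified_once[OF assms(2)] assms(3,4)] .
  have ex': "V_ex ?\<psi>' = V_ex \<psi> - {y}"
    using fresh V_ex_replace_Exists[of y D \<phi> \<psi>] by (auto simp: vars_def V_Q_def)
  have "y \<notin> V_all \<psi>"
    using fresh by (auto simp: vars_def V_Q_def)
  then have free': "V_free V ?\<psi>' = insert y (V_free V \<psi>)"
    using y_V ex' by (auto simp: V_free_def V_Q_def)
  have dom: "V_free V ?\<psi>' \<union> V_ex ?\<psi>' = V_free V \<psi> \<union> V_ex \<psi>"
    using ex' free' y_ex by auto
  \<comment> \<open>The quantifier keeps \<open>y\<close> in \<open>vars \<psi>\<close>, so
    irrelevance of \<open>s y\<close> is read off \<open>?\<psi>'\<close>, which has the same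
    matrix; by \<open>dom\<close> the same variables are substituted.\<close>
  have app: "apply_candidate V (s(y := f)) \<psi> = apply_candidate V s \<psi>"
    "apply_candidate V s ?\<psi>' = apply_candidate V s \<psi>" for s f
    using subst_matrix_upd[OF fresh] dom
    by (simp_all add: apply_candidate_def subst_matrix_replace_Exists)
  \<comment> \<open>The value \<open>False\<close> is arbitrary; any constant would do.\<close>
  have "s(y := \<lambda>_. False) \<in> sem V ?\<psi>'" if "s \<in> sem V \<psi>" for s
    using that candidate_upd_const[of s V \<psi> ?\<psi>' y False] dom y_ex ex' free'
    by (auto simp: sem_def app dep_replace_Exists)
  moreover have "s(y := \<lambda>_. False) \<in> sem V \<psi>" if "s \<in> sem V ?\<psi>'" for s
    using that candidate_upd_const[of s V ?\<psi>' \<psi> y False] dom y_ex ex' free'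
    by (auto simp: sem_def app dep_replace_Exists)
  ultimately show ?thesis
    unfolding equisat_def by blast
qed

end
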